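(* Let $m=2$ and $k=3$. For any $U>0$ there exists a matrix $A\in\mathbb{R}^{m\times k}_{\ge0}$ such that the $A$-knapsack polytope $\mathcal{B}=\{x\in\Delta_k:Ax\le\mathbf{1}\}$ satisfies $\mathrm{Lip}(\mathcal{B})\ge U$.
   Context: $\Delta_k=\{x\in\mathbb{R}^k_{\ge0}:\|x\|_1=1\}$. For convex $\mathcal{B}\subseteq\Delta_k$: $\sigma:[n]\times[k]\to\mathbb{R}_{\ge0}$ satisfies $\sigma\sim(\mathcal{B},h)$ if $\sum_p\sigma(p,\cdot)=h$ and $\sigma(p,\cdot)\in\|\sigma(p,\cdot)\|_1\mathcal{B}$ for all $p$. For $h,h'\in\mathcal{B}$ and $\sigma\sim(\mathcal{B},h)$ with $\|\sigma\|_1=1$, $\mathrm{OAT}(\mathcal{B},h,h',\sigma)=\min\|\sigma-\sigma'\|_1$ over $\sigma'\sim(\mathcal{B},h')$ with $\|\sigma'(p,\cdot)\|_1=\|\sigma(p,\cdot)\|_1$ for all $p$, and $\mathrm{Lip}(\mathcal{B})=\max\mathrm{OAT}(\mathcal{B},h,h',\sigma)/\|h-h'\|_1$ over all such $h\ne h'$, $\sigma$, $n$. *)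

theory Defs
  imports "HOL-Analysis.Analysis"
begin

definition l1_norm :: "real ^ 'k \<Rightarrow> real" where
  "l1_norm x = (\<Sum>j\<in>UNIV. \<bar>x $ j\<bar>)"

definition prob_simplex :: "(real ^ 'k) set" where
  "prob_simplex = {x. (\<forall>j. 0 \<le> x $ j) \<and> l1_norm x = 1}"

(* The number n of rows is quantified over in the Lipschitz constant, so a function
   [n] x [k] -> R is encoded as a sequence of row vectors; only rows 1..n matter. *)

definition alloc_norm :: "nat \<Rightarrow> (nat \<Rightarrow> real ^ 'k) \<Rightarrow> real" where
  "alloc_norm n \<sigma> = (\<Sum>p\<in>{1..n}. l1_norm (\<sigma> p))"

(* sigma ~ (B, h) *)
definition alloc :: "nat \<Rightarrow> (real ^ 'k) set \<Rightarrow> real ^ 'k \<Rightarrow> (nat \<Rightarrow> real ^ 'k) \<Rightarrow> bool" where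
  "alloc n B h \<sigma> \<longleftrightarrow>
     (\<forall>p\<in>{1..n}. \<forall>j. 0 \<le> \<sigma> p $ j) \<and>
     (\<Sum>p\<in>{1..n}. \<sigma> p) = h \<and>
     (\<forall>p\<in>{1..n}. \<sigma> p \<in> (\<lambda>x. l1_norm (\<sigma> p) *\<^sub>R x) ` B)"

(* The infimum is over a set of nonnegative reals, nonempty whenever h' is in B and
   sigma has norm 1 (take the rows l1_norm (sigma p) *\<^sub>R h'); it is a minimum when B is compact. *)
definition OAT :: "nat \<Rightarrow> (real ^ 'k) set \<Rightarrow> real ^ 'k \<Rightarrow> real ^ 'k \<Rightarrow> (nat \<Rightarrow> real ^ 'k) \<Rightarrow> real" where
  "OAT n B h h' \<sigma> =
     Inf {alloc_norm n (\<lambda>p. \<sigma> p - \<sigma>' p) | \<sigma>'.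
            alloc n B h' \<sigma>' \<and> (\<forall>p\<in>{1..n}. l1_norm (\<sigma>' p) = l1_norm (\<sigma> p))}"

(* Extended-real supremum, so that no boundedness or attainment is presupposed. *)
definition Lip :: "(real ^ 'k) set \<Rightarrow> ereal" where
  "Lip B =
     Sup {ereal (OAT n B h h' \<sigma> / l1_norm (h - h')) | n h h' \<sigma>.
            h \<in> B \<and> h' \<in> B \<and> h \<noteq> h' \<and> alloc n B h \<sigma> \<and> alloc_norm n \<sigma> = 1}"

(* The order on vectors is componentwise, and 1 is the all-ones vector. *)
definition knapsack_polytope :: "real ^ 'k ^ 'm \<Rightarrow> (real ^ 'k) set" where
  "knapsack_polytope A = {x \<in> prob_simplex. A *v x \<le> 1}"

end

(* A vertex v of B whose angle is close to pi: an allocation to v must put every row at v,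
   whereas two points of B lying far from v in nearly opposite directions average to a point
   close to v. Here v is the midpoint of an edge of the simplex, and a single cut through v,
   almost parallel to that edge, makes the vertex; both rows of A are this cut. *)

theory Submission
  imports Defs
begin

lemma l1_norm_3: "l1_norm (x :: real ^ 3) = \<bar>x $ 1\<bar> + \<bar>x $ 2\<bar> + \<bar>x $ 3\<bar>"
  by (simp add: l1_norm_def sum_3)

lemma l1_norm_nonneg: "0 \<le> l1_norm x"
  by (simp add: l1_norm_def sum_nonneg)

lemma OAT_div_le_Lip:
  assumes "h \<in> B" "h' \<in> B" "h \<noteq> h'" "alloc n B h \<sigma>" "alloc_norm n \<sigma> = 1"
  shows "ereal (OAT n B h h' \<sigma> / l1_norm (h - h')) \<le> Lip B"
  unfolding Lip_def by (rule Sup_upper) (use assms in blast)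

text \<open>Equal rows make the two constraints coincide, and on nonnegative vectors the l1 norm is
  the plain coordinate sum.\<close>

lemma mem_knapsack_polytope_same_rows:
  fixes a x :: "real ^ 3"
  shows "x \<in> knapsack_polytope (\<chi> i::2. a) \<longleftrightarrow>
    0 \<le> x $ 1 \<and> 0 \<le> x $ 2 \<and> 0 \<le> x $ 3 \<and> x $ 1 + x $ 2 + x $ 3 = 1 \<and>
    a $ 1 * x $ 1 + a $ 2 * x $ 2 + a $ 3 * x $ 3 \<le> 1"
  by (auto simp: knapsack_polytope_def prob_simplex_def l1_norm_3 forall_3 less_eq_vec_def
      matrix_vector_mult_def sum_3)

text \<open>The left side has the form that \<open>{1..2}\<close> takes after simp rewrites the
  natural number \<open>1\<close> to \<open>Suc 0\<close>.\<close>

lemma atLeastAtMost_Suc_0_2: "{Suc 0..2} = {1, 2}"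
  by auto

theorem theorem5p16:
  fixes U :: real
  assumes "U > 0"
  shows "\<exists>A :: real ^ 3 ^ 2. (\<forall>i j. 0 \<le> A $ i $ j) \<and> Lip (knapsack_polytope A) \<ge> ereal U"
proof -
  \<comment> \<open>The cut \<open>(2 + 2*U) * x $ 1 + 2*U * x $ 2 \<le> 1 + 2*U\<close>, scaled to
    right-hand side 1; it is tight at \<open>v\<close> and at \<open>b\<^sub>2\<close>.\<close>
  define a :: "real ^ 3" where "a = vector [(2 + 2*U) / (1 + 2*U), 2*U / (1 + 2*U), 0]"
  define B where "B = knapsack_polytope (\<chi> i::2. a)"
  \<comment> \<open>The third coordinate of the point where the cut line meets the side
    \<open>x $ 2 = 0\<close> of the simplex; that point is \<open>b\<^sub>2\<close>.\<close>
  define s where "s = 1 / (2 + 2*U)"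
  define v :: "real ^ 3" where "v = vector [1/2, 1/2, 0]"
  define b\<^sub>1 :: "real ^ 3" where "b\<^sub>1 = vector [0, 1, 0]"
  define b\<^sub>2 :: "real ^ 3" where "b\<^sub>2 = vector [1 - s, 0, s]"
  define \<sigma> where "\<sigma> = (\<lambda>p::nat. (1/2) *\<^sub>R (if p = 1 then b\<^sub>1 else b\<^sub>2))"
  define h where "h = (1/2) *\<^sub>R b\<^sub>1 + (1/2) *\<^sub>R b\<^sub>2"
  have a: "a $ 1 = (2 + 2*U) / (1 + 2*U)" "a $ 2 = 2*U / (1 + 2*U)" "a $ 3 = 0"
    and v: "v $ 1 = 1/2" "v $ 2 = 1/2" "v $ 3 = 0"
    and b1: "b\<^sub>1 $ 1 = 0" "b\<^sub>1 $ 2 = 1" "b\<^sub>1 $ 3 = 0"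
    and b2: "b\<^sub>2 $ 1 = 1 - s" "b\<^sub>2 $ 2 = 0" "b\<^sub>2 $ 3 = s"
    by (simp_all add: a_def v_def b\<^sub>1_def b\<^sub>2_def)
  have s: "0 < s" "s < 1" "1 - s = (1 + 2*U) / (2 + 2*U)"
    using assms by (simp_all add: s_def field_simps)
  have mem_B: "x \<in> B \<longleftrightarrow> 0 \<le> x $ 1 \<and> 0 \<le> x $ 2 \<and> 0 \<le> x $ 3 \<and> x $ 1 + x $ 2 + x $ 3 = 1 \<and>
      (2 + 2*U) * x $ 1 + 2*U * x $ 2 \<le> 1 + 2*U" for x
  proof -
    have "a $ 1 * x $ 1 + a $ 2 * x $ 2 + a $ 3 * x $ 3 = ((2 + 2*U) * x $ 1 + 2*U * x $ 2) / (1 + 2*U)"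
      by (simp add: a add_divide_distrib algebra_simps)
    then show ?thesis
      using assms by (simp add: B_def mem_knapsack_polytope_same_rows pos_divide_le_eq)
  qed
  have vB: "v \<in> B" and b1B: "b\<^sub>1 \<in> B" and b2B: "b\<^sub>2 \<in> B"
    using assms s by (simp_all add: mem_B v b1 b2)
  have hB: "h \<in> B"
    using b1B b2B unfolding mem_B h_def by (simp add: field_simps)
  have l1_half: "l1_norm ((1/2) *\<^sub>R x) = 1/2" if "x \<in> B" for x
    using that by (simp add: mem_B l1_norm_3)
  \<comment> \<open>Used twice: with \<open>b\<^sub>1\<close>, \<open>b\<^sub>2\<close> for
    \<open>\<sigma>\<close>, and with \<open>v\<close>, \<open>v\<close> for a feasible
    target.\<close>
  have alloc_half: "alloc 2 B ((1/2) *\<^sub>R x + (1/2) *\<^sub>R y) (\<lambda>p. (1/2) *\<^sub>R (if p = 1 then x else y))"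
    if "x \<in> B" "y \<in> B" for x y
  proof -
    have "0 \<le> x $ j \<and> 0 \<le> y $ j" for j
      using that exhaust_3[of j] by (auto simp: mem_B)
    moreover have "(1/2) *\<^sub>R x \<in> (\<lambda>z. (1/2) *\<^sub>R z) ` B" "(1/2) *\<^sub>R y \<in> (\<lambda>z. (1/2) *\<^sub>R z) ` B"
      using that by blast+
    ultimately show ?thesis
      by (simp add: alloc_def atLeastAtMost_Suc_0_2 l1_half[OF that(1)] l1_half[OF that(2)])
  qed
  have norm_\<sigma>: "l1_norm (\<sigma> p) = 1/2" for p
    using l1_half b1B b2B by (simp add: \<sigma>_def)
  have "1/2 \<le> OAT 2 B h v \<sigma>"
    unfolding OAT_def
  proof (rule cInf_greatest)
    \<comment> \<open>A real \<open>Inf\<close> can be bounded below only over a nonempty set;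
      putting both rows at \<open>v\<close> gives a member.\<close>
    have "alloc 2 B v (\<lambda>p. (1/2) *\<^sub>R v)"
      using alloc_half[OF vB vB] by (simp flip: scaleR_left_distrib)
    then show "{alloc_norm 2 (\<lambda>p. \<sigma> p - \<sigma>' p) |\<sigma>'.
        alloc 2 B v \<sigma>' \<and> (\<forall>p\<in>{1..2}. l1_norm (\<sigma>' p) = l1_norm (\<sigma> p))} \<noteq> {}"
      unfolding norm_\<sigma> using l1_half[OF vB] by blast
  next
    fix t
    assume "t \<in> {alloc_norm 2 (\<lambda>p. \<sigma> p - \<sigma>' p) |\<sigma>'.
        alloc 2 B v \<sigma>' \<and> (\<forall>p\<in>{1..2}. l1_norm (\<sigma>' p) = l1_norm (\<sigma> p))}"
    then obtain \<sigma>' where t: "t = alloc_norm 2 (\<lambda>p. \<sigma> p - \<sigma>' p)" and al: "alloc 2 B v \<sigma>'"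
      and "\<forall>p\<in>{1..2}. l1_norm (\<sigma>' p) = 1/2"
      using norm_\<sigma> by auto
    then obtain x y where x: "x \<in> B" "\<sigma>' (Suc 0) = (1/2) *\<^sub>R x" and y: "y \<in> B" "\<sigma>' 2 = (1/2) *\<^sub>R y"
      and sum: "\<sigma>' (Suc 0) + \<sigma>' 2 = v"
      by (auto simp: alloc_def atLeastAtMost_Suc_0_2)
    have eq: "x $ 1 + y $ 1 = 1" "x $ 2 + y $ 2 = 1" "x $ 3 + y $ 3 = 0"
      using arg_cong[OF sum, of "\<lambda>z. z $ 1"] arg_cong[OF sum, of "\<lambda>z. z $ 2"]
        arg_cong[OF sum, of "\<lambda>z. z $ 3"] by (simp_all add: x y v)
    \<comment> \<open>On the edge \<open>z $ 3 = 0\<close>, substituting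
      \<open>z $ 2 = 1 - z $ 1\<close> reduces the cut to \<open>2 * z $ 1 \<le> 1\<close>, so
      \<open>B\<close> ends at \<open>v\<close> there.\<close>
    have le_half: "z $ 1 \<le> 1/2" if "z \<in> B" "z $ 3 = 0" for z
    proof -
      have z2: "z $ 2 = 1 - z $ 1"
        using that by (simp add: mem_B)
      have "(2 + 2*U) * z $ 1 + 2*U * z $ 2 \<le> 1 + 2*U"
        using that by (simp add: mem_B)
      then show ?thesis
        unfolding z2 by (simp add: algebra_simps)
    qed
    \<comment> \<open>Nonnegative numbers with sum 0 vanish. Then both first coordinates are at most
      1/2 and add up to 1, which forces \<open>x = v\<close>.\<close>
    have "x $ 3 = 0" "y $ 3 = 0"
      using x y eq by (auto simp: mem_B)
    then have "x $ 1 = 1/2" "x $ 2 = 1/2"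
      using le_half[OF x(1)] le_half[OF y(1)] eq x(1) by (auto simp: mem_B)
    \<comment> \<open>The first row alone suffices: it moves from half of \<open>b\<^sub>1\<close>
      to half of \<open>v\<close>, at cost 1/4 in each of two coordinates.\<close>
    then have "1/2 \<le> l1_norm (\<sigma> (Suc 0) - \<sigma>' (Suc 0))"
      by (simp add: l1_norm_3 \<sigma>_def x b1)
    also have "\<dots> \<le> t"
      using l1_norm_nonneg[of "\<sigma> 2 - \<sigma>' 2"] by (simp add: t alloc_norm_def atLeastAtMost_Suc_0_2)
    finally show "1/2 \<le> t" .
  qed
  \<comment> \<open>The difference \<open>h - v\<close> is \<open>(-s/2, 0, s/2)\<close>.\<close>
  moreover have dist: "l1_norm (h - v) = s"
    using s(1,2) by (simp add: l1_norm_3 h_def b1 b2 v field_simps)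
  ultimately have "(1/2) / s \<le> OAT 2 B h v \<sigma> / l1_norm (h - v)"
    unfolding dist using s(1) by (intro divide_right_mono) simp_all
  \<comment> \<open>The quotient equals \<open>1 + U\<close>.\<close>
  moreover have "U \<le> (1/2) / s"
    using assms by (simp add: s_def field_simps)
  ultimately have "ereal U \<le> ereal (OAT 2 B h v \<sigma> / l1_norm (h - v))"
    by simp
  also have "\<dots> \<le> Lip B"
  proof (rule OAT_div_le_Lip[OF hB vB])
    show "h \<noteq> v"
      using dist s(1) by (auto simp: l1_norm_def)
    show "alloc 2 B h \<sigma>"
      unfolding h_def \<sigma>_def by (rule alloc_half[OF b1B b2B])
    show "alloc_norm 2 \<sigma> = 1"
      by (simp add: alloc_norm_def atLeastAtMost_Suc_0_2 norm_\<sigma>)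
  qed
  finally show ?thesis
    using assms by (intro exI[of _ "\<chi> i::2. a"]) (simp add: B_def forall_3 a)
qed

end
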